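(* For any lattice knot $K$, \[ \delta(K)\geq \delta_V(K)\geq \frac{\delta(K)}{\sqrt{3}}-1 . \]
   Context: A polygonal knot is a knot (embedded circle in $\mathbb{R}^3$) that consists of finitely many line segments. The cubic lattice is $\mathbb{L}^3=(\mathbb{R}\times\mathbb{Z}\times\mathbb{Z})\cup(\mathbb{Z}\times\mathbb{R}\times\mathbb{Z})\cup(\mathbb{Z}\times\mathbb{Z}\times\mathbb{R})\subset\mathbb{R}^3$. A lattice knot is a polygonal knot contained in $\mathbb{L}^3$. Its vertices are the points of $V(K):=K\cap\mathbb{Z}^3$. For $a,b\in K$, $d_K(a,b)$ is the length of the shortest path from $a$ to $b$ in $K$, $d(a,b)$ is the Euclidean distance, and $d_1(a,b)=\sum_{i=1}^3|a_i-b_i|$. The Gromov distortion of $K$ is $\delta(K):=\sup_{a,b\in K}\frac{d_K(a,b)}{d(a,b)}$ and the vertex distortion of a lattice knot $K$ is $\delta_V(K):=\max_{a,b\in V(K)}\frac{d_K(a,b)}{d_1(a,b)}$, where in both cases the ratio is taken to be $1$ when $a=b$. *)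

theory Defs
  imports "HOL-Analysis.Analysis"
begin

definition knot :: "(real^3) set \<Rightarrow> bool" where
  "knot K \<longleftrightarrow> K homeomorphic sphere (0::complex) 1"

definition polygonal_knot :: "(real^3) set \<Rightarrow> bool" where
  "polygonal_knot K \<longleftrightarrow> knot K \<and>
     (\<exists>S. finite S \<and> (\<forall>s\<in>S. \<exists>a b. s = closed_segment a b) \<and> K = \<Union>S)"

definition cubic_lattice :: "(real^3) set" where
  "cubic_lattice =
     {x. x $ 2 \<in> \<int> \<and> x $ 3 \<in> \<int>} \<union>
     {x. x $ 1 \<in> \<int> \<and> x $ 3 \<in> \<int>} \<union>
     {x. x $ 1 \<in> \<int> \<and> x $ 2 \<in> \<int>}"

definition lattice_knot :: "(real^3) set \<Rightarrow> bool" where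
  "lattice_knot K \<longleftrightarrow> polygonal_knot K \<and> K \<subseteq> cubic_lattice"

definition knot_vertices :: "(real^3) set \<Rightarrow> (real^3) set" where
  "knot_vertices K = K \<inter> {x. \<forall>i. x $ i \<in> \<int>}"

(* The length of a path is its total variation on [0,1]: the supremum of the lengths of
   the polygons inscribed at t 0 \<le> ... \<le> t n. It is infinite for non-rectifiable paths. *)
definition path_length :: "(real \<Rightarrow> 'a::metric_space) \<Rightarrow> ereal" where
  "path_length g =
     Sup {ereal (\<Sum>i<n. dist (g (t i)) (g (t (Suc i)))) | (n::nat) (t::nat \<Rightarrow> real).
            mono_on {..n} t \<and> t ` {..n} \<subseteq> {0..1}}"

(* The infimum is taken in the extended reals, so it is \<infinity> if a and b cannot be joined
   by a rectifiable path in K; for a polygonal knot K it is finite and attained. *)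
definition intrinsic_dist :: "'a::metric_space set \<Rightarrow> 'a \<Rightarrow> 'a \<Rightarrow> ereal" where
  "intrinsic_dist K a b =
     Inf {path_length g | g. path g \<and> path_image g \<subseteq> K \<and> pathstart g = a \<and> pathfinish g = b}"

definition taxicab_dist :: "real^3 \<Rightarrow> real^3 \<Rightarrow> real" where
  "taxicab_dist a b = (\<Sum>i\<in>UNIV. \<bar>a $ i - b $ i\<bar>)"

definition gromov_distortion :: "(real^3) set \<Rightarrow> ereal" where
  "gromov_distortion K =
     (SUP (a, b)\<in>K \<times> K. if a = b then 1 else intrinsic_dist K a b / ereal (dist a b))"

(* For a lattice knot the set of vertices is finite and nonempty, as Max requires. *)
definition vertex_distortion :: "(real^3) set \<Rightarrow> ereal" where
  "vertex_distortion K =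
     Max ((\<lambda>(a, b). if a = b then 1 else intrinsic_dist K a b / ereal (taxicab_dist a b)) `
          (knot_vertices K \<times> knot_vertices K))"

end

theory Submission
  imports Defs
begin

text \<open>
  Removing a point from a circle leaves it connected. Hence a lattice knot that meets the interior
  of a unit lattice edge contains the whole edge, and every point of the knot can be moved along
  the knot to a lattice point. Given two points \<open>a\<close>, \<open>b\<close> of the knot, one moves them to the ends of
  their edges that face each other, in which case the lengths \<open>d\<^sub>1\<close> just add up. This fails
  only for parallel edges facing each other side by side. Then one moves both points to the same
  side: the detour is at most 1, and \<open>d\<^sub>1(a, b) \<ge> 1\<close>. So
  \<open>d\<^sub>K \<le> (\<delta>\<^sub>V + 1) d\<^sub>1\<close> on the whole knot, and \<open>d\<^sub>1 \<le> \<surd>3 d\<close>.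
\<close>

section \<open>Length of paths and the intrinsic distance\<close>

lemma path_length_upper:
  assumes "mono_on {..n} t" "t ` {..n} \<subseteq> {0..1}"
  shows "ereal (\<Sum>i<n. dist (g (t i)) (g (t (Suc i)))) \<le> path_length g"
  unfolding path_length_def using assms by (intro Sup_upper) blast

lemma path_length_least:
  assumes "\<And>n t. mono_on {..n} t \<Longrightarrow> t ` {..n} \<subseteq> {0..1} \<Longrightarrow>
    ereal (\<Sum>i<n. dist (g (t i)) (g (t (Suc i)))) \<le> B"
  shows "path_length g \<le> B"
  unfolding path_length_def using assms by (intro Sup_least) blast

lemma path_length_nonneg: "0 \<le> path_length g"
  using path_length_upper[of 0 "\<lambda>_. 0" g] by (simp add: zero_ereal_def monotone_on_def)

text \<open>On a segment each step has length proportional to its parameter increment, so the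
  inscribed sums telescope to \<open>(t n - t 0) * dist a b\<close>.\<close>

lemma path_length_linepath: "path_length (linepath a b) \<le> ereal (dist a b)"
  for a b :: "'a::real_normed_vector"
proof (rule path_length_least)
  fix n and t :: "nat \<Rightarrow> real"
  assume t: "mono_on {..n} t" "t ` {..n} \<subseteq> {0..1}"
  have "dist (linepath a b (t i)) (linepath a b (t (Suc i))) = (t (Suc i) - t i) * dist a b"
    if "i < n" for i
  proof -
    have "t i \<le> t (Suc i)"
      using t(1) that by (auto simp: monotone_on_def)
    moreover have "linepath a b (t i) - linepath a b (t (Suc i)) = (t (Suc i) - t i) *\<^sub>R (a - b)"
      by (simp add: linepath_def algebra_simps)
    ultimately show ?thesis
      by (simp add: dist_norm)
  qed
  then have "(\<Sum>i<n. dist (linepath a b (t i)) (linepath a b (t (Suc i)))) =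
      (\<Sum>i<n. t (Suc i) - t i) * dist a b"
    by (simp add: sum_distrib_right)
  also have "\<dots> = (t n - t 0) * dist a b"
    by (simp add: sum_lessThan_telescope)
  also have "\<dots> \<le> 1 * dist a b"
  proof (rule mult_right_mono)
    have "t n \<in> {0..1}" "t 0 \<in> {0..1}"
      using t(2) by auto
    then show "t n - t 0 \<le> 1"
      by simp
  qed simp
  finally show "ereal (\<Sum>i<n. dist (linepath a b (t i)) (linepath a b (t (Suc i)))) \<le> ereal (dist a b)"
    by simp
qed

text \<open>Every partition for the join induces one for each of the two paths, and the triangle
  inequality at the junction handles the step that crosses it.\<close>

lemma path_length_joinpaths:
  assumes "pathfinish g = pathstart h"
  shows "path_length (g +++ h) \<le> path_length g + path_length h"
proof (rule path_length_least)
  fix n and t :: "nat \<Rightarrow> real"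
  assume t: "mono_on {..n} t" "t ` {..n} \<subseteq> {0..1}"
  \<comment> \<open>These are the times of the two halves, clamped to the unit interval. Both
    sequences keep all \<open>n\<close> steps; a step in the other half is constant and adds
    0.\<close>
  define u where "u i = min (2 * t i) 1" for i
  define v where "v i = max (2 * t i - 1) 0" for i
  have u: "mono_on {..n} u" "u ` {..n} \<subseteq> {0..1}" and v: "mono_on {..n} v" "v ` {..n} \<subseteq> {0..1}"
    using t by (fastforce simp: monotone_on_def u_def v_def image_subset_iff)+
  have join: "(g +++ h) (t i) = (if t i \<le> 1/2 then g (u i) else h (v i))" for i
    by (simp add: joinpaths_def u_def v_def)
  have u1: "g (u i) = pathfinish g" if "t i \<ge> 1/2" for i
    using that by (simp add: u_def pathfinish_def)
  have v0: "h (v i) = pathfinish g" if "t i \<le> 1/2" for i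
    using that assms by (simp add: v_def pathstart_def)
  have "dist ((g +++ h) (t i)) ((g +++ h) (t (Suc i))) \<le>
      dist (g (u i)) (g (u (Suc i))) + dist (h (v i)) (h (v (Suc i)))" if "i < n" for i
  proof -
    have le: "t i \<le> t (Suc i)"
      using t(1) that by (auto simp: monotone_on_def)
    consider "t (Suc i) \<le> 1/2" | "1/2 < t i" | "t i \<le> 1/2" "1/2 < t (Suc i)"
      by linarith
    then show ?thesis
    proof cases
      \<comment> \<open>The step crosses the junction: \<open>u (Suc i) = 1\<close> and
        \<open>v i = 0\<close>, so both stand for the common point
        \<open>pathfinish g\<close>.\<close>
      case 3
      then show ?thesis
        using dist_triangle[of "g (u i)" "h (v (Suc i))" "pathfinish g"] u1[of "Suc i"] v0[of i]
        by (simp add: join)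
    qed (use le in \<open>auto simp: join\<close>)
  qed
  then have "(\<Sum>i<n. dist ((g +++ h) (t i)) ((g +++ h) (t (Suc i)))) \<le>
      (\<Sum>i<n. dist (g (u i)) (g (u (Suc i)))) + (\<Sum>i<n. dist (h (v i)) (h (v (Suc i))))"
    unfolding sum.distrib[symmetric] by (intro sum_mono) auto
  then have "ereal (\<Sum>i<n. dist ((g +++ h) (t i)) ((g +++ h) (t (Suc i)))) \<le>
      ereal (\<Sum>i<n. dist (g (u i)) (g (u (Suc i)))) + ereal (\<Sum>i<n. dist (h (v i)) (h (v (Suc i))))"
    by simp
  also have "\<dots> \<le> path_length g + path_length h"
    by (intro add_mono path_length_upper u v)
  finally show "ereal (\<Sum>i<n. dist ((g +++ h) (t i)) ((g +++ h) (t (Suc i)))) \<le>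
      path_length g + path_length h" .
qed

lemma intrinsic_dist_nonneg: "0 \<le> intrinsic_dist K a b"
  unfolding intrinsic_dist_def by (rule Inf_greatest) (auto simp: path_length_nonneg)

lemma intrinsic_dist_le:
  assumes "path g" "path_image g \<subseteq> K" "pathstart g = a" "pathfinish g = b"
  shows "intrinsic_dist K a b \<le> path_length g"
  unfolding intrinsic_dist_def using assms by (intro Inf_lower) blast

text \<open>The lower bound passes to the infimum over one set at a time, by subtracting the other
  summand. In \<open>ereal\<close> this is sound only for finite summands; nonnegativity excludes
  minus infinity, and plus infinity is treated separately.\<close>

lemma Inf_add_Inf_ge_ereal:
  fixes A B :: "ereal set"
  assumes "\<And>x y. x \<in> A \<Longrightarrow> y \<in> B \<Longrightarrow> c \<le> x + y" "\<And>x. x \<in> A \<Longrightarrow> 0 \<le> x" "\<And>y. y \<in> B \<Longrightarrow> 0 \<le> y"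
  shows "c \<le> Inf A + Inf B"
proof -
  have AB: "0 \<le> Inf A" "0 \<le> Inf B"
    using assms by (auto intro: Inf_greatest)
  have *: "c \<le> x + Inf B" if "x \<in> A" for x
  proof (cases "x = \<infinity>")
    case False
    then have x: "\<bar>x\<bar> \<noteq> \<infinity>"
      using assms(2)[OF that] by auto
    then have "c - x \<le> Inf B"
      using assms(1)[OF that] by (intro Inf_greatest) (auto simp: ereal_minus_le add.commute)
    then show ?thesis
      using x by (auto simp: ereal_minus_le add.commute)
  qed (use AB in auto)
  show ?thesis
  proof (cases "Inf B = \<infinity>")
    case False
    then have B: "\<bar>Inf B\<bar> \<noteq> \<infinity>"
      using AB by auto
    then have "c - Inf B \<le> Inf A"
      using * by (intro Inf_greatest) (auto simp: ereal_minus_le)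
    then show ?thesis
      using B by (auto simp: ereal_minus_le)
  qed (use AB in auto)
qed

text \<open>Concatenate a path from \<open>a\<close> to \<open>b\<close> with one from
  \<open>b\<close> to \<open>c\<close>, then pass to the infima; the argument also covers infinite
  distances.\<close>

lemma intrinsic_dist_triangle: "intrinsic_dist K a c \<le> intrinsic_dist K a b + intrinsic_dist K b c"
  unfolding intrinsic_dist_def[of K a b] intrinsic_dist_def[of K b c]
proof (rule Inf_add_Inf_ge_ereal)
  fix x y
  assume "x \<in> {path_length g |g. path g \<and> path_image g \<subseteq> K \<and> pathstart g = a \<and> pathfinish g = b}"
    and "y \<in> {path_length g |g. path g \<and> path_image g \<subseteq> K \<and> pathstart g = b \<and> pathfinish g = c}"
  then obtain g h where
    g: "x = path_length g" "path g" "path_image g \<subseteq> K" "pathstart g = a" "pathfinish g = b" and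
    h: "y = path_length h" "path h" "path_image h \<subseteq> K" "pathstart h = b" "pathfinish h = c"
    by blast
  then have "path (g +++ h)" "path_image (g +++ h) \<subseteq> K" "pathstart (g +++ h) = a" "pathfinish (g +++ h) = c"
    by (simp_all add: path_image_join)
  then have "intrinsic_dist K a c \<le> path_length (g +++ h)"
    by (rule intrinsic_dist_le)
  also have "\<dots> \<le> x + y"
    unfolding g(1) h(1) by (rule path_length_joinpaths) (simp add: g h)
  finally show "intrinsic_dist K a c \<le> x + y" .
qed (auto simp: path_length_nonneg)

lemma intrinsic_dist_segment:
  fixes a b :: "'a::real_normed_vector"
  assumes "closed_segment a b \<subseteq> K"
  shows "intrinsic_dist K a b \<le> ereal (dist a b)"
proof -
  have "intrinsic_dist K a b \<le> path_length (linepath a b)"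
    by (rule intrinsic_dist_le) (use assms in simp_all)
  then show ?thesis
    by (rule order_trans[OF _ path_length_linepath])
qed

section \<open>The taxicab metric\<close>

lemma dist_le_taxicab: "dist a b \<le> taxicab_dist a b"
  unfolding taxicab_dist_def dist_norm using norm_le_l1_cart[of "a - b"] by simp

text \<open>Cauchy-Schwarz with three coordinates; this is the source of the factor
  \<open>sqrt 3\<close>.\<close>

lemma taxicab_le_dist: "taxicab_dist a b \<le> sqrt 3 * dist a b"
proof -
  have "(taxicab_dist a b)\<^sup>2 \<le> 3 * (\<Sum>i\<in>UNIV. \<bar>a $ i - b $ i\<bar>\<^sup>2)"
    unfolding taxicab_dist_def
    using sum_squared_le_sum_of_squares[of "\<lambda>i. \<bar>a $ i - b $ i\<bar>" "UNIV :: 3 set"] by simp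
  also have "(\<Sum>i\<in>UNIV. \<bar>a $ i - b $ i\<bar>\<^sup>2) = (dist a b)\<^sup>2"
    by (simp add: dist_norm norm_vec_def L2_set_def sum_nonneg)
  finally have "(taxicab_dist a b)\<^sup>2 \<le> (sqrt 3 * dist a b)\<^sup>2"
    by (simp add: power_mult_distrib)
  then show ?thesis
    by (rule power2_le_imp_le) simp
qed

text \<open>The route runs straight from \<open>a\<close> to \<open>v\<close>, inside
  \<open>K\<close> to \<open>w\<close>, and straight to \<open>b\<close>. It will be used with
  \<open>v\<close> and \<open>w\<close> vertices of the knot.\<close>

lemma intrinsic_dist_le_via:
  fixes a b v w :: "real^3"
  assumes "closed_segment a v \<subseteq> K" "closed_segment b w \<subseteq> K"
    and "intrinsic_dist K v w \<le> ereal C"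
    and "taxicab_dist a v + C + taxicab_dist b w \<le> D"
  shows "intrinsic_dist K a b \<le> ereal D"
proof -
  have av: "intrinsic_dist K a v \<le> ereal (taxicab_dist a v)"
    by (rule order_trans[OF intrinsic_dist_segment[OF assms(1)]]) (simp add: dist_le_taxicab)
  have "intrinsic_dist K w b \<le> ereal (dist b w)"
    using intrinsic_dist_segment[of w b K] assms(2) by (simp add: closed_segment_commute dist_commute)
  then have wb: "intrinsic_dist K w b \<le> ereal (taxicab_dist b w)"
    by (rule order_trans) (simp add: dist_le_taxicab)
  have "intrinsic_dist K a b \<le> intrinsic_dist K a v + (intrinsic_dist K v w + intrinsic_dist K w b)"
    by (rule order_trans[OF intrinsic_dist_triangle add_left_mono[OF intrinsic_dist_triangle]])
  also have "\<dots> \<le> ereal (taxicab_dist a v) + (ereal C + ereal (taxicab_dist b w))"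
    by (intro add_mono av wb assms)
  also have "\<dots> \<le> ereal D"
    using assms(4) by simp
  finally show ?thesis .
qed

section \<open>Lattice knots contain whole edges\<close>

lemma connected_sphere_punctured: "connected (sphere (0::complex) 1 - {p})"
proof (cases "p \<in> sphere 0 1")
  case True
  \<comment> \<open>Stereographic projection: the punctured circle is a line, here the imaginary
    axis.\<close>
  then have "(sphere 0 1 - {p}) homeomorphic {x. (1::complex) \<bullet> x = 0}"
    by (intro homeomorphic_punctured_sphere_hyperplane) auto
  then show ?thesis
    using homeomorphic_connectedness convex_connected convex_hyperplane by blast
next
  case False
  then show ?thesis
    by (simp add: connected_sphere)
qed

lemma knot_punctured_connected:
  assumes "knot K"
  shows "connected (K - {p})"
proof -
  obtain f g where fg: "homeomorphism (sphere (0::complex) 1) K f g"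
    using assms homeomorphic_sym unfolding knot_def homeomorphic_def by blast
  have "K - {p} = f ` (sphere 0 1 - {g p})" if "p \<in> K"
    using fg that unfolding homeomorphism_def by (auto simp: image_iff)
  moreover have "K - {p} = f ` sphere 0 1" if "p \<notin> K"
    using fg that unfolding homeomorphism_def by auto
  moreover have "continuous_on (sphere 0 1) f"
    using fg by (simp add: homeomorphism_def)
  moreover have "connected (sphere (0::complex) 1)"
    by (simp add: connected_sphere)
  ultimately show ?thesis
    using connected_sphere_punctured[of "g p"]
    by (metis Diff_subset connected_continuous_image continuous_on_subset)
qed

lemma knot_compact: "knot K \<Longrightarrow> compact K"
  using homeomorphic_compactness compact_sphere unfolding knot_def by blast

lemma knot_not_singleton:
  assumes "knot K"
  obtains y where "y \<in> K" "y \<noteq> x"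
proof -
  have "uncountable (sphere (0::complex) 1)"
    by (rule connected_uncountable[of _ 1 "-1"]) (simp_all add: connected_sphere)
  then have "infinite (sphere (0::complex) 1)"
    by (rule uncountable_infinite)
  moreover have "sphere (0::complex) 1 homeomorphic K"
    using assms unfolding knot_def by (rule homeomorphic_sym[THEN iffD1])
  ultimately have "infinite K"
    using homeomorphic_finite[THEN iffD1, THEN conjunct1] by metis
  then have "\<not> K \<subseteq> {x}"
    using finite_subset[of K "{x}"] by auto
  then show ?thesis
    using that by blast
qed

section \<open>Coordinates in the lattice and moves along one axis\<close>

lemma cubic_lattice_coords:
  "x \<in> cubic_lattice \<longleftrightarrow> (\<exists>i. \<forall>j. j \<noteq> i \<longrightarrow> x $ j \<in> \<int>)"
proof -
  have "(\<exists>i. P i) \<longleftrightarrow> P 1 \<or> P 2 \<or> P 3" for P :: "3 \<Rightarrow> bool"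
    by (metis exhaust_3)
  then show ?thesis
    unfolding cubic_lattice_def by (simp add: forall_3)
qed

text \<open>For fixed \<open>x\<close> and \<open>i\<close>, varying \<open>r\<close> parametrises
  the line through \<open>x\<close> in direction \<open>i\<close>. Edges and their ends are
  expressed this way.\<close>

definition vec_upd :: "'a^'n \<Rightarrow> 'n \<Rightarrow> 'a \<Rightarrow> 'a^'n" where
  "vec_upd x i r = (\<chi> j. if j = i then r else x $ j)"

lemma vec_upd_nth [simp]: "vec_upd x i r $ j = (if j = i then r else x $ j)"
  by (simp add: vec_upd_def)

lemma vec_upd_triv [simp]: "vec_upd x i (x $ i) = x"
  by (simp add: vec_eq_iff)

lemma vec_upd_nth_eq_iff: "x = vec_upd y i r \<longleftrightarrow> x $ i = r \<and> (\<forall>j. j \<noteq> i \<longrightarrow> x $ j = y $ j)"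
  by (auto simp: vec_eq_iff)

lemma closed_segment_vec_upd:
  fixes x :: "real^'n"
  assumes "z \<in> closed_segment x (vec_upd x i r)"
  obtains s where "s \<in> closed_segment (x $ i) r" "z = vec_upd x i s"
proof -
  obtain u where u: "0 \<le> u" "u \<le> 1" "z = (1 - u) *\<^sub>R x + u *\<^sub>R vec_upd x i r"
    using assms by (auto simp: in_segment)
  have "z = vec_upd x i ((1 - u) * x $ i + u * r)"
    unfolding u(3) by (auto simp: vec_eq_iff algebra_simps)
  moreover have "(1 - u) * x $ i + u * r \<in> closed_segment (x $ i) r"
    using u by (auto simp: in_segment)
  ultimately show ?thesis
    using that by blast
qed

text \<open>The part of the knot strictly between \<open>p\<close> and the missing point \<open>c\<close> of the edge is open and
  closed in the knot punctured at \<open>p\<close>, hence it is everything.\<close>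

lemma punctured_knot_in_gap:
  fixes K :: "(real^3) set" and x :: "real^3" and n :: int and p c :: real
  assumes K: "knot K" "K \<subseteq> cubic_lattice" and x: "x \<in> K" "\<And>j. j \<noteq> i \<Longrightarrow> x $ j \<in> \<int>"
    and p: "n \<le> p" "p \<le> n + 1" and c: "n \<le> c" "c \<le> n + 1" "vec_upd x i c \<notin> K"
    and between: "(x $ i - p) * (x $ i - c) < 0"
    and y: "y \<in> K" "y \<noteq> vec_upd x i p"
  shows "(\<forall>j. j \<noteq> i \<longrightarrow> y $ j = x $ j) \<and> (y $ i - p) * (y $ i - c) < 0"
proof -
  \<comment> \<open>\<open>W\<close> is open and \<open>C\<close> is closed: strict bounds and a
    tolerance below 1 in \<open>W\<close>, weak bounds and exact equality in \<open>C\<close>. On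
    the punctured knot the two sets coincide.\<close>
  define W where "W = {z :: real^3. (z $ i - p) * (z $ i - c) < 0} \<inter>
    (\<Inter>j\<in>- {i}. {z. \<bar>z $ j - x $ j\<bar> < 1})"
  define C where "C = {z :: real^3. (z $ i - p) * (z $ i - c) \<le> 0} \<inter>
    (\<Inter>j\<in>- {i}. {z. z $ j = x $ j})"
  \<comment> \<open>Such a point has a non-integral coordinate \<open>i\<close>, so the lattice
    forces its other coordinates to be integers, and integers less than 1 apart are equal.\<close>
  have W_line: "z $ j = x $ j" if z: "z \<in> K" "z \<in> W" and j: "j \<noteq> i" for z j
  proof -
    have "(z $ i - p) * (z $ i - c) < 0"
      using z by (simp add: W_def)
    then have "n < z $ i" "z $ i < n + 1"
      using p c by (auto simp: mult_less_0_iff)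
    then have "z $ i \<notin> \<int>"
      by (auto elim!: Ints_cases)
    moreover obtain k where "\<And>l. l \<noteq> k \<Longrightarrow> z $ l \<in> \<int>"
      using z(1) K(2) cubic_lattice_coords[of z] by blast
    ultimately have "z $ j \<in> \<int>"
      using j by metis
    then have "z $ j - x $ j \<in> \<int>"
      using x(2)[OF j] by simp
    moreover have "\<bar>z $ j - x $ j\<bar> < 1"
      using z(2) j by (auto simp: W_def)
    ultimately show ?thesis
      using Ints_nonzero_abs_less1 by force
  qed
  \<comment> \<open>The weak bound becomes strict because one end is the puncture and the other is
    missing from \<open>K\<close>.\<close>
  have C_W: "z \<in> W" if z: "z \<in> K - {vec_upd x i p}" "z \<in> C" for z
  proof -
    have line: "z $ j = x $ j" if "j \<noteq> i" for j
      using z that by (auto simp: C_def)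
    have "z \<noteq> vec_upd x i p" "z \<noteq> vec_upd x i c"
      using z c(3) by blast+
    then have "z $ i \<noteq> p" "z $ i \<noteq> c"
      using line by (simp_all add: vec_upd_nth_eq_iff)
    moreover have "(z $ i - p) * (z $ i - c) \<le> 0"
      using z by (auto simp: C_def)
    ultimately show ?thesis
      using line by (auto simp: W_def less_le)
  qed
  have "open W"
    unfolding W_def
    by (intro open_Int open_INT ballI open_Collect_less continuous_intros) simp
  have "open (- C)"
    unfolding C_def
    by (intro open_Compl closed_Int closed_INT ballI closed_Collect_le closed_Collect_eq continuous_intros)
  have "x \<in> W \<inter> (K - {vec_upd x i p})"
    using x between by (auto simp: W_def vec_upd_nth_eq_iff)
  have "K - {vec_upd x i p} \<subseteq> W \<union> - C"
    using C_W by blast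
  have W_C: "z \<in> C" if "z \<in> K" "z \<in> W" for z
    using W_line[OF that] that(2) by (auto simp: W_def C_def)
  then have "W \<inter> - C \<inter> (K - {vec_upd x i p}) = {}"
    by blast
  have "W \<inter> (K - {vec_upd x i p}) = {} \<or> - C \<inter> (K - {vec_upd x i p}) = {}"
    by (rule connectedD) (fact knot_punctured_connected[OF K(1)] | fact)+
  then have "- C \<inter> (K - {vec_upd x i p}) = {}"
    using \<open>x \<in> W \<inter> (K - {vec_upd x i p})\<close> by blast
  then have "y \<in> W"
    using y C_W by blast
  then have "(y $ i - p) * (y $ i - c) < 0"
    by (simp add: W_def)
  then show ?thesis
    using W_line[OF y(1) \<open>y \<in> W\<close>] by blast
qed

text \<open>If a point of the edge were missing, a puncture beyond \<open>x\<close> would confine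
  the whole knot to a piece of this edge. A puncture between two of its points would then disconnect
  the knot.\<close>

lemma lattice_knot_edge:
  fixes K :: "(real^3) set" and x :: "real^3"
  assumes K: "knot K" "K \<subseteq> cubic_lattice" and x: "x \<in> K" "\<And>j. j \<noteq> i \<Longrightarrow> x $ j \<in> \<int>"
    and c: "of_int \<lfloor>x $ i\<rfloor> \<le> c" "c \<le> of_int \<lceil>x $ i\<rceil>"
  shows "vec_upd x i c \<in> K"
proof (rule ccontr)
  assume miss: "vec_upd x i c \<notin> K"
  define n where "n = \<lfloor>x $ i\<rfloor>"
  have ne: "x $ i \<noteq> c"
    using miss x(1) by auto
  have nonint: "x $ i \<noteq> of_int n"
  proof
    assume "x $ i = of_int n"
    then have "\<lceil>x $ i\<rceil> = n" "\<lfloor>x $ i\<rfloor> = n"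
      by simp_all
    then show False
      using c ne \<open>x $ i = of_int n\<close> by simp
  qed
  have xn: "n < x $ i" "x $ i < n + 1"
    using nonint unfolding n_def by linarith+
  have cn: "n \<le> c" "c \<le> n + 1"
    using c unfolding n_def by (simp_all add: ceiling_altdef split: if_splits)
  \<comment> \<open>The puncture lies on the side of \<open>x\<close> away from \<open>c\<close>, so
    \<open>x\<close> is strictly between the two.\<close>
  define p where "p = (if x $ i < c then (n + x $ i) / 2 else (x $ i + (n + 1)) / 2)"
  have p: "n < p" "p < n + 1"
    using xn by (auto simp: p_def)
  have xp: "(x $ i - p) * (x $ i - c) < 0"
    unfolding mult_less_0_iff using xn ne by (auto simp: p_def)
  obtain y where y: "y \<in> K" "y \<noteq> x"
    using knot_not_singleton[OF K(1)] .
  \<comment> \<open>The confinement result with any base point \<open>b\<close> of \<open>K\<close>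
    on the line of \<open>x\<close>, so that it applies both to \<open>x\<close> and to a second
    point \<open>y\<close>.\<close>
  have gap: "(\<forall>j. j \<noteq> i \<longrightarrow> z $ j = x $ j) \<and> (z $ i - q) * (z $ i - c) < 0"
    if b: "b \<in> K" "\<And>j. j \<noteq> i \<Longrightarrow> b $ j = x $ j" "(b $ i - q) * (b $ i - c) < 0"
      and z: "z \<in> K" "z \<noteq> vec_upd x i q" and q: "n < q" "q < n + 1" for b z and q :: real
  proof -
    have "vec_upd b i r = vec_upd x i r" for r
      using b(2) by (simp add: vec_eq_iff)
    then show ?thesis
      using punctured_knot_in_gap[of K b i n q c z] K x b z q cn miss by simp
  qed
  have y_line: "y $ j = x $ j" if "j \<noteq> i" for j
    using gap[of x p y] x y p xp that by (cases "y = vec_upd x i p") auto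
  have "y $ i = p \<or> (y $ i - p) * (y $ i - c) < 0"
    using gap[of x p y] x y p xp by (cases "y = vec_upd x i p") auto
  then have yn: "n < y $ i" "y $ i < n + 1" and side: "(x $ i - c) * (y $ i - c) > 0"
    using p cn xp by (auto simp: mult_less_0_iff zero_less_mult_iff)
  have yx: "y $ i \<noteq> x $ i"
    using y(2) y_line by (metis vec_eq_iff)
  \<comment> \<open>The midpoint separates \<open>x\<close> from \<open>y\<close>, while
    \<open>c\<close> lies outside the interval they span. Hence exactly one of them is between
    \<open>q\<close> and \<open>c\<close>, whereas \<open>gap\<close>, applied from either point,
    makes this hold for both or neither.\<close>
  define q where "q = (x $ i + y $ i) / 2"
  have q: "n < q" "q < n + 1"
    using xn yn by (auto simp: q_def)
  have "x \<noteq> vec_upd x i q" "y \<noteq> vec_upd x i q"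
    using yx by (auto simp: vec_upd_nth_eq_iff q_def)
  then have "(x $ i - q) * (x $ i - c) < 0 \<longleftrightarrow> (y $ i - q) * (y $ i - c) < 0"
    using gap[of x q y] gap[of y q x] x(1) y(1) y_line q by auto
  moreover have "2 * q = x $ i + y $ i"
    by (simp add: q_def)
  ultimately show False
    using yx side unfolding mult_less_0_iff zero_less_mult_iff by linarith
qed

lemma lattice_knot_edge_segment:
  fixes K :: "(real^3) set" and x :: "real^3"
  assumes "knot K" "K \<subseteq> cubic_lattice" "x \<in> K" "\<And>j. j \<noteq> i \<Longrightarrow> x $ j \<in> \<int>"
    and r: "of_int \<lfloor>x $ i\<rfloor> \<le> r" "r \<le> of_int \<lceil>x $ i\<rceil>"
  shows "closed_segment x (vec_upd x i r) \<subseteq> K"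
proof
  fix z
  assume "z \<in> closed_segment x (vec_upd x i r)"
  then obtain s where s: "s \<in> closed_segment (x $ i) r" "z = vec_upd x i s"
    by (rule closed_segment_vec_upd)
  have "of_int \<lfloor>x $ i\<rfloor> \<le> s" "s \<le> of_int \<lceil>x $ i\<rceil>"
    using s(1) r of_int_floor_le[of "x $ i"] le_of_int_ceiling[of "x $ i"]
    unfolding closed_segment_eq_real_ivl by (auto split: if_splits simp del: of_int_floor_le le_of_int_ceiling)
  then show "z \<in> K"
    using lattice_knot_edge assms s(2) by blast
qed

section \<open>Vertices of a lattice knot\<close>

lemma knot_vertices_upd:
  fixes K :: "(real^3) set" and x :: "real^3"
  assumes "knot K" "K \<subseteq> cubic_lattice" "x \<in> K" "\<And>j. j \<noteq> i \<Longrightarrow> x $ j \<in> \<int>"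
    and "r = of_int \<lfloor>x $ i\<rfloor> \<or> r = of_int \<lceil>x $ i\<rceil>"
  shows "vec_upd x i r \<in> knot_vertices K \<and> closed_segment x (vec_upd x i r) \<subseteq> K"
proof -
  have "of_int \<lfloor>x $ i\<rfloor> \<le> (of_int \<lceil>x $ i\<rceil> :: real)"
    using of_int_floor_le[of "x $ i"] le_of_int_ceiling[of "x $ i"] by linarith
  then have r: "of_int \<lfloor>x $ i\<rfloor> \<le> r" "r \<le> of_int \<lceil>x $ i\<rceil>"
    using assms(5) by auto
  have "closed_segment x (vec_upd x i r) \<subseteq> K"
    using lattice_knot_edge_segment[of K x i r] assms r by blast
  moreover from this have "vec_upd x i r \<in> K"
    by blast
  ultimately show ?thesis
    using assms(4,5) by (auto simp: knot_vertices_def)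
qed

lemma knot_vertices_nonempty:
  assumes "knot K" "K \<subseteq> cubic_lattice"
  shows "knot_vertices K \<noteq> {}"
proof -
  obtain x where "x \<in> K"
    using knot_not_singleton[OF assms(1)] by metis
  moreover from this obtain i where "\<And>j. j \<noteq> i \<Longrightarrow> x $ j \<in> \<int>"
    using assms(2) cubic_lattice_coords[of x] by blast
  ultimately show ?thesis
    using knot_vertices_upd[of K x i "of_int \<lfloor>x $ i\<rfloor>"] assms by blast
qed

lemma finite_knot_vertices:
  assumes "knot K"
  shows "finite (knot_vertices K)"
proof -
  obtain B where B: "\<And>x. x \<in> K \<Longrightarrow> norm x \<le> B"
    using knot_compact[OF assms] compact_imp_bounded bounded_iff by metis
  \<comment> \<open>Each coordinate of a vertex is an integer in a bounded range, which leaves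
    finitely many vectors.\<close>
  have "knot_vertices K \<subseteq> vec_lambda ` (UNIV \<rightarrow>\<^sub>E {k. k \<in> \<int> \<and> \<bar>k\<bar> \<le> B})"
  proof
    fix x
    assume x: "x \<in> knot_vertices K"
    then have "\<bar>x $ i\<bar> \<le> B" for i
      using B[of x] component_le_norm_cart[of x i] by (simp add: knot_vertices_def)
    then have "(\<lambda>i. x $ i) \<in> UNIV \<rightarrow>\<^sub>E {k. k \<in> \<int> \<and> \<bar>k\<bar> \<le> B}"
      using x by (auto simp: knot_vertices_def)
    then show "x \<in> vec_lambda ` (UNIV \<rightarrow>\<^sub>E {k. k \<in> \<int> \<and> \<bar>k\<bar> \<le> B})"
      by (intro image_eqI[of _ _ "\<lambda>i. x $ i"]) simp_all
  qed
  then show ?thesis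
    by (rule finite_subset) (intro finite_imageI finite_PiE finite finite_abs_int_segment)
qed

section \<open>Comparison of the distortions\<close>

lemma sum_eq_single_UNIV:
  assumes "\<And>j. j \<noteq> i \<Longrightarrow> f j = 0"
  shows "sum f UNIV = f (i :: 'n :: finite)"
proof -
  have "sum f (UNIV - {i}) = 0"
    using assms by (intro sum.neutral) blast
  then show ?thesis
    using sum.remove[of UNIV i f] by simp
qed

lemma taxicab_vec_upd: "taxicab_dist x (vec_upd x i r) = \<bar>x $ i - r\<bar>"
  unfolding taxicab_dist_def using sum_eq_single_UNIV[of i "\<lambda>j. \<bar>x $ j - vec_upd x i r $ j\<bar>"] by simp

text \<open>Rounding \<open>x\<close> towards the integer \<open>m\<close> cannot overshoot
  \<open>m\<close>, so \<open>r\<close> lies between the two.\<close>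

lemma abs_diff_int_via_rounding:
  fixes x :: real and m :: int
  defines "r \<equiv> if x \<le> of_int m then of_int \<lceil>x\<rceil> else of_int \<lfloor>x\<rfloor> :: real"
  shows "\<bar>x - of_int m\<bar> = \<bar>x - r\<bar> + \<bar>r - of_int m\<bar>"
proof (cases "x \<le> of_int m")
  case True
  then have "\<lceil>x\<rceil> \<le> m"
    by (rule ceiling_le)
  then show ?thesis
    unfolding r_def using True by simp
next
  case False
  then have "m \<le> \<lfloor>x\<rfloor>"
    by (simp add: le_floor_iff)
  then show ?thesis
    unfolding r_def using False by simp
qed

text \<open>The straight pieces are absorbed by \<open>1 \<le> M\<close>; the additional 1 in
  \<open>M + 1\<close> pays for the detour between parallel edges that lie side by side.\<close>

lemma intrinsic_dist_le_taxicab: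
  fixes K :: "(real^3) set"
  assumes K: "knot K" "K \<subseteq> cubic_lattice" and M: "1 \<le> M"
    and vert: "\<And>v w. v \<in> knot_vertices K \<Longrightarrow> w \<in> knot_vertices K \<Longrightarrow>
      intrinsic_dist K v w \<le> ereal (M * taxicab_dist v w)"
    and a: "a \<in> K" and b: "b \<in> K"
  shows "intrinsic_dist K a b \<le> ereal ((M + 1) * taxicab_dist a b)"
proof -
  obtain i where i: "\<And>j. j \<noteq> i \<Longrightarrow> a $ j \<in> \<int>"
    using a K(2) cubic_lattice_coords[of a] by blast
  obtain k where k: "\<And>j. j \<noteq> k \<Longrightarrow> b $ j \<in> \<int>"
    using b K(2) cubic_lattice_coords[of b] by blast
  note upd_a = knot_vertices_upd[OF K a i]
  note upd_b = knot_vertices_upd[OF K b k]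
  have nonneg: "0 \<le> taxicab_dist x y" for x y
    by (simp add: taxicab_dist_def sum_nonneg)
  have via: ?thesis
    if r: "r = of_int \<lfloor>a $ i\<rfloor> \<or> r = of_int \<lceil>a $ i\<rceil>" and s: "s = of_int \<lfloor>b $ k\<rfloor> \<or> s = of_int \<lceil>b $ k\<rceil>"
      and le: "\<bar>a $ i - r\<bar> + M * taxicab_dist (vec_upd a i r) (vec_upd b k s) + \<bar>b $ k - s\<bar> \<le>
        (M + 1) * taxicab_dist a b" for r s
  proof (rule intrinsic_dist_le_via)
    show "closed_segment a (vec_upd a i r) \<subseteq> K" "closed_segment b (vec_upd b k s) \<subseteq> K"
      using upd_a[OF _ r] upd_b[OF _ s] by blast+
    show "intrinsic_dist K (vec_upd a i r) (vec_upd b k s) \<le>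
        ereal (M * taxicab_dist (vec_upd a i r) (vec_upd b k s))"
      using upd_a[OF _ r] upd_b[OF _ s] by (intro vert) blast+
  qed (use le in \<open>simp add: taxicab_vec_upd\<close>)
  \<comment> \<open>If the moved points lie in order between \<open>a\<close> and \<open>b\<close>
    in every coordinate, the three lengths add up exactly to \<open>taxicab_dist a b\<close>, and
    already the factor \<open>M\<close> suffices.\<close>
  have facing: ?thesis
    if r: "r = of_int \<lfloor>a $ i\<rfloor> \<or> r = of_int \<lceil>a $ i\<rceil>" and s: "s = of_int \<lfloor>b $ k\<rfloor> \<or> s = of_int \<lceil>b $ k\<rceil>"
      and eq: "\<And>j. \<bar>a $ j - b $ j\<bar> = \<bar>a $ j - vec_upd a i r $ j\<bar> +
        \<bar>vec_upd a i r $ j - vec_upd b k s $ j\<bar> + \<bar>b $ j - vec_upd b k s $ j\<bar>" for r s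
  proof (rule via[OF r s])
    let ?v = "vec_upd a i r" and ?w = "vec_upd b k s"
    have sum: "taxicab_dist a b = \<bar>a $ i - r\<bar> + taxicab_dist ?v ?w + \<bar>b $ k - s\<bar>"
      unfolding taxicab_vec_upd[symmetric] unfolding taxicab_dist_def sum.distrib[symmetric]
      by (intro sum.cong refl eq)
    have "\<bar>a $ i - r\<bar> + M * taxicab_dist ?v ?w + \<bar>b $ k - s\<bar> \<le> M * taxicab_dist a b"
      using M mult_right_mono[of 1 M "\<bar>a $ i - r\<bar>"] mult_right_mono[of 1 M "\<bar>b $ k - s\<bar>"]
      by (simp add: sum algebra_simps)
    then show "\<bar>a $ i - r\<bar> + M * taxicab_dist ?v ?w + \<bar>b $ k - s\<bar> \<le> (M + 1) * taxicab_dist a b"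
      using nonneg[of a b] by (simp add: algebra_simps)
  qed
  show ?thesis
  proof (cases "i = k")
    case False
    \<comment> \<open>For different directions, \<open>b $ i\<close> and \<open>a $ k\<close> are
      integers, so each point is rounded towards the integral coordinate of the other.\<close>
    define r where "r = (if a $ i \<le> b $ i then of_int \<lceil>a $ i\<rceil> else of_int \<lfloor>a $ i\<rfloor> :: real)"
    define s where "s = (if b $ k \<le> a $ k then of_int \<lceil>b $ k\<rceil> else of_int \<lfloor>b $ k\<rfloor> :: real)"
    obtain m n :: int where mn: "b $ i = m" "a $ k = n"
      using k[of i] i[of k] False by (metis Ints_cases)
    have "\<bar>a $ i - b $ i\<bar> = \<bar>a $ i - r\<bar> + \<bar>r - b $ i\<bar>"
      unfolding r_def mn using abs_diff_int_via_rounding[of "a $ i" m] by simp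
    moreover have "\<bar>a $ k - b $ k\<bar> = \<bar>a $ k - s\<bar> + \<bar>b $ k - s\<bar>"
      unfolding s_def mn using abs_diff_int_via_rounding[of "b $ k" n] by (simp add: abs_minus_commute)
    ultimately show ?thesis
      using False by (intro facing[of r s]) (auto simp: r_def s_def)
  next
    case [simp]: True
    \<comment> \<open>Either the edge intervals in direction \<open>i\<close> are ordered, possibly
      sharing an end, or they overlap properly. In the last case both are the same unit interval
      with non-integral points.\<close>
    consider "\<lceil>a $ i\<rceil> \<le> \<lfloor>b $ i\<rfloor>" | "\<lceil>b $ i\<rceil> \<le> \<lfloor>a $ i\<rfloor>"
      | "\<lfloor>b $ i\<rfloor> < \<lceil>a $ i\<rceil>" "\<lfloor>a $ i\<rfloor> < \<lceil>b $ i\<rceil>"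
      by linarith
    then show ?thesis
    proof cases
      case 1
      have "\<bar>a $ i - b $ i\<bar> = \<bar>a $ i - \<lceil>a $ i\<rceil>\<bar> + \<bar>of_int \<lceil>a $ i\<rceil> - of_int \<lfloor>b $ i\<rfloor>\<bar> + \<bar>b $ i - \<lfloor>b $ i\<rfloor>\<bar>"
        using 1 by linarith
      then show ?thesis
        by (intro facing[of "of_int \<lceil>a $ i\<rceil>" "of_int \<lfloor>b $ i\<rfloor>"]) auto
    next
      case 2
      have "\<bar>a $ i - b $ i\<bar> = \<bar>a $ i - \<lfloor>a $ i\<rfloor>\<bar> + \<bar>of_int \<lfloor>a $ i\<rfloor> - of_int \<lceil>b $ i\<rceil>\<bar> + \<bar>b $ i - \<lceil>b $ i\<rceil>\<bar>"
        using 2 by linarith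
      then show ?thesis
        by (intro facing[of "of_int \<lfloor>a $ i\<rfloor>" "of_int \<lceil>b $ i\<rceil>"]) auto
    next
      case 3
      define n where "n = \<lfloor>a $ i\<rfloor>"
      have "\<lceil>x\<rceil> \<le> \<lfloor>x\<rfloor> + 1" for x :: real
        by linarith
      from this[of "a $ i"] this[of "b $ i"]
      have n: "\<lfloor>a $ i\<rfloor> = n" "\<lceil>a $ i\<rceil> = n + 1" "\<lfloor>b $ i\<rfloor> = n" "\<lceil>b $ i\<rceil> = n + 1"
        using 3 unfolding n_def by linarith+
      show ?thesis
      proof (cases "\<forall>j. j \<noteq> i \<longrightarrow> a $ j = b $ j")
        case True
        then have b_eq: "b = vec_upd a i (b $ i)"
          by (simp add: vec_upd_nth_eq_iff)
        have "of_int \<lfloor>a $ i\<rfloor> \<le> b $ i" "b $ i \<le> of_int \<lceil>a $ i\<rceil>"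
          using n by linarith+
        then have "closed_segment a b \<subseteq> K"
          using lattice_knot_edge_segment[OF K a i, where r = "b $ i"] b_eq by metis
        then have "intrinsic_dist K a b \<le> ereal (dist a b)"
          by (rule intrinsic_dist_segment)
        also have "dist a b \<le> (M + 1) * taxicab_dist a b"
          using dist_le_taxicab[of a b] mult_right_mono[of 1 "M + 1" "taxicab_dist a b"] M nonneg[of a b]
          by simp
        finally show ?thesis
          by simp
      next
        case False
        then obtain j where j: "j \<noteq> i" "a $ j \<noteq> b $ j"
          by blast
        \<comment> \<open>The edges are distinct and parallel, so they differ by a nonzero integer
          in some transverse coordinate.\<close>
        have "1 \<le> \<bar>a $ j - b $ j\<bar>"
          using i[of j] k[of j] j by (intro Ints_nonzero_abs_ge1) auto
        also have "\<dots> \<le> taxicab_dist a b"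
          unfolding taxicab_dist_def by (intro member_le_sum) auto
        finally have ge1: "1 \<le> taxicab_dist a b" .
        have same_side: ?thesis
          if r: "r = of_int \<lfloor>a $ i\<rfloor> \<or> r = of_int \<lceil>a $ i\<rceil>" "r = of_int \<lfloor>b $ k\<rfloor> \<or> r = of_int \<lceil>b $ k\<rceil>"
            and detour: "\<bar>a $ i - r\<bar> + \<bar>b $ i - r\<bar> \<le> 1" for r
        proof (rule via[OF r])
          \<comment> \<open>After both points move to level \<open>r\<close>, coordinate
            \<open>i\<close> contributes 0 and the others are unchanged.\<close>
          have "taxicab_dist (vec_upd a i r) (vec_upd b k r) \<le> taxicab_dist a b"
            unfolding taxicab_dist_def by (intro sum_mono) auto
          then have "M * taxicab_dist (vec_upd a i r) (vec_upd b k r) \<le> M * taxicab_dist a b"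
            using M by (intro mult_left_mono) auto
          then show "\<bar>a $ i - r\<bar> + M * taxicab_dist (vec_upd a i r) (vec_upd b k r) + \<bar>b $ k - r\<bar> \<le>
              (M + 1) * taxicab_dist a b"
            using detour ge1 by (simp add: algebra_simps)
        qed
        have "n \<le> a $ i" "a $ i \<le> n + 1" "n \<le> b $ i" "b $ i \<le> n + 1"
          using n by linarith+
        \<comment> \<open>The detours through the two ends sum to 2, so one of them is at most
          1.\<close>
        then consider "\<bar>a $ i - n\<bar> + \<bar>b $ i - n\<bar> \<le> 1" | "\<bar>a $ i - (n + 1)\<bar> + \<bar>b $ i - (n + 1)\<bar> \<le> 1"
          by linarith
        then show ?thesis
          using same_side[of n] same_side[of "n + 1"] n by cases auto
      qed
    qed
  qed
qed

section \<open>Assembling the two inequalities\<close>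

lemma vertex_distortion_upper:
  assumes "knot K" "v \<in> knot_vertices K" "w \<in> knot_vertices K"
  shows "(if v = w then 1 else intrinsic_dist K v w / ereal (taxicab_dist v w)) \<le> vertex_distortion K"
  unfolding vertex_distortion_def
  by (intro Max_ge finite_imageI finite_cartesian_product finite_knot_vertices assms)
    (use assms in \<open>force simp: image_iff\<close>)

lemma gromov_distortion_upper:
  assumes "a \<in> K" "b \<in> K"
  shows "(if a = b then 1 else intrinsic_dist K a b / ereal (dist a b)) \<le> gromov_distortion K"
  unfolding gromov_distortion_def using assms by (intro SUP_upper2[of "(a, b)"]) auto

theorem theorem1p3:
  fixes K :: "(real^3) set"
  assumes "lattice_knot K"
  shows "gromov_distortion K \<ge> vertex_distortion K \<and>
         vertex_distortion K \<ge> gromov_distortion K / ereal (sqrt 3) - 1"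
proof
  have K: "knot K" "K \<subseteq> cubic_lattice"
    using assms by (auto simp: lattice_knot_def polygonal_knot_def)
  obtain v where v: "v \<in> knot_vertices K"
    using knot_vertices_nonempty[OF K] by blast
  \<comment> \<open>Replacing the Euclidean by the larger taxicab distance in the denominator only
    decreases a nonnegative ratio.\<close>
  have ratio_le: "(if a = b then 1 else intrinsic_dist K a b / ereal (taxicab_dist a b)) \<le>
      gromov_distortion K" if "a \<in> K" "b \<in> K" for a b
  proof (cases "a = b")
    case False
    then have "0 < dist a b"
      by simp
    moreover from this have "0 < taxicab_dist a b"
      using dist_le_taxicab[of a b] by linarith
    ultimately have "intrinsic_dist K a b / ereal (taxicab_dist a b) \<le> intrinsic_dist K a b / ereal (dist a b)"
      using intrinsic_dist_nonneg[of K a b] dist_le_taxicab[of a b]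
      by (cases "intrinsic_dist K a b") (auto intro!: divide_left_mono mult_pos_pos simp del: zero_less_dist_iff)
    then show ?thesis
      using False gromov_distortion_upper[OF that] by auto
  qed (use gromov_distortion_upper[OF that] in auto)
  show "vertex_distortion K \<le> gromov_distortion K"
    unfolding vertex_distortion_def
  proof (intro Max.boundedI finite_imageI finite_cartesian_product finite_knot_vertices K)
    fix z
    assume "z \<in> (\<lambda>(a, b). if a = b then 1 else intrinsic_dist K a b / ereal (taxicab_dist a b)) `
      (knot_vertices K \<times> knot_vertices K)"
    then obtain a b where "a \<in> knot_vertices K" "b \<in> knot_vertices K"
      "z = (if a = b then 1 else intrinsic_dist K a b / ereal (taxicab_dist a b))"
      by auto
    then show "z \<le> gromov_distortion K"
      using ratio_le[of a b] by (simp add: knot_vertices_def)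
  qed (use v in auto)
  \<comment> \<open>The pair \<open>(v, v)\<close> contributes the conventional value 1. This gives
    \<open>1 \<le> M\<close> below and excludes minus infinity; for plus infinity the claim is
    immediate.\<close>
  have ge1: "1 \<le> vertex_distortion K"
    using vertex_distortion_upper[OF K(1) v v] by simp
  show "gromov_distortion K / ereal (sqrt 3) - 1 \<le> vertex_distortion K"
  proof (cases "vertex_distortion K")
    case (real M)
    then have M: "1 \<le> M"
      using ge1 by simp
    have vert: "intrinsic_dist K v w \<le> ereal (M * taxicab_dist v w)"
      if vw: "v \<in> knot_vertices K" "w \<in> knot_vertices K" for v w
    proof (cases "v = w")
      case True
      then show ?thesis
        using intrinsic_dist_segment[of v v K] vw by (simp add: knot_vertices_def taxicab_dist_def)
    next
      case False
      then have "0 < taxicab_dist v w"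
        using dist_le_taxicab[of v w] by (metis zero_less_dist_iff less_le_trans)
      then show ?thesis
        using vertex_distortion_upper[OF K(1) vw] False real
        by (simp add: ereal_divide_le_pos mult.commute)
    qed
    have "(if a = b then 1 else intrinsic_dist K a b / ereal (dist a b)) \<le> ereal (sqrt 3 * (M + 1))"
      if ab: "a \<in> K" "b \<in> K" for a b
    proof (cases "a = b")
      case True
      \<comment> \<open>The conventional ratio 1 on the diagonal must also respect the
        bound.\<close>
      have "1 * 1 \<le> sqrt 3 * (M + 1)"
        using M by (intro mult_mono) auto
      then show ?thesis
        using True by (simp add: one_ereal_def)
    next
      case False
      have "intrinsic_dist K a b \<le> ereal ((M + 1) * taxicab_dist a b)"
        using intrinsic_dist_le_taxicab[OF K M vert ab] .
      also have "\<dots> \<le> ereal ((M + 1) * (sqrt 3 * dist a b))"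
        using M by (simp add: taxicab_le_dist)
      finally show ?thesis
        using False by (simp add: ereal_divide_le_pos mult_ac)
    qed
    then have "gromov_distortion K \<le> ereal (sqrt 3 * (M + 1))"
      unfolding gromov_distortion_def by (intro SUP_least) auto
    then have "gromov_distortion K / ereal (sqrt 3) \<le> ereal (M + 1)"
      by (simp add: ereal_divide_le_pos)
    then show ?thesis
      using real by (simp add: ereal_minus_le one_ereal_def)
  qed (use ge1 in auto)
qed

end
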